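(* Let $n\ge 2$ be an integer, let $u>0$, let $\mathcal P=\{(x,y,z)\in\mathbb{R}^{n-2}\times\mathbb{R}_+\times\mathbb{R}_+ : \|x\|^2\le 2yz,\ z\le u\}$, and let $\tilde P=\{(x,y,z)\in\mathcal P : \|x\|^2=2yz,\ z=u\}$. Suppose $(x,y,z)\in\tilde P$ and $(\hat x,\hat y,\hat z)\in\mathbb{R}^{n-2}\times\mathbb{R}\times\mathbb{R}$. Then $P_{\mathcal P}(\hat x,\hat y,\hat z)=(x,y,z)$ if and only if all of the following hold: (i) $\hat y\le\frac{\|x\|^2}{2u}$; (ii) $\|x\|\le\|\hat x\|$; (iii) $\hat z\ge u-\frac1u\,x\cdot(\hat x-x)-\frac yu\left(\hat y-\frac{\|x\|^2}{2u}\right)$; (iv) $x=\frac{2u^2}{\|x\|^2-2u\hat y+2u^2}\,\hat x$.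
   Context: $\|\cdot\|$ is the Euclidean norm and $\cdot$ the dot product. $P_{\mathcal P}(\mathsf w)$ denotes the Euclidean projection of $\mathsf w\in\mathbb{R}^n$ onto the closed convex set $\mathcal P$, i.e. the unique minimizer of $\|\mathsf v-\mathsf w\|$ over $\mathsf v\in\mathcal P$. Points of $\mathbb{R}^n$ are written $(x,y,z)$ with $x\in\mathbb{R}^{n-2}$ and $y,z\in\mathbb{R}$. *)

theory Defs
  imports "HOL-Analysis.Analysis"
begin

text \<open>
  The space \<open>\<real>\<^sup>m\<close> is rendered as a type \<open>'a :: {real_inner, heine_borel}\<close>, i.e. a
  finite-dimensional real inner product space, and \<open>\<real>\<^sup>m \<times> \<real> \<times> \<real>\<close> as \<open>'a \<times> real \<times> real\<close>,
  whose inner product and norm are the Euclidean ones. This is the sort on which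
  \<^const>\<open>closest_point\<close> (Euclidean projection) is defined. Every \<^class>\<open>euclidean_space\<close>, in
  particular \<open>real ^ 'm\<close>, is an instance, but these all have positive dimension. The case
  \<open>m = 0\<close> is covered by the type \<^typ>\<open>unit\<close>, which is made an instance here.
\<close>

instantiation unit :: real_inner
begin

definition zero_unit :: unit where "zero_unit = ()"
definition plus_unit :: "unit \<Rightarrow> unit \<Rightarrow> unit" where "plus_unit _ _ = ()"
definition scaleR_unit :: "real \<Rightarrow> unit \<Rightarrow> unit" where "scaleR_unit _ _ = ()"
definition inner_unit :: "unit \<Rightarrow> unit \<Rightarrow> real" where "inner_unit _ _ = 0"
definition norm_unit :: "unit \<Rightarrow> real" where "norm_unit _ = 0"
definition sgn_unit :: "unit \<Rightarrow> unit" where "sgn_unit _ = ()"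
definition dist_unit :: "unit \<Rightarrow> unit \<Rightarrow> real" where "dist_unit _ _ = 0"
definition uniformity_unit :: "(unit \<times> unit) filter" where
  "uniformity_unit = (INF e\<in>{0<..}. principal {(x, y). dist x y < e})"
definition open_unit :: "unit set \<Rightarrow> bool" where
  "open_unit U \<longleftrightarrow> (\<forall>x\<in>U. \<forall>\<^sub>F (x', y) in uniformity. x' = x \<longrightarrow> y \<in> U)"

instance
  by standard (simp_all add: inner_unit_def norm_unit_def dist_unit_def uniformity_unit_def
      open_unit_def)

end

instance unit :: heine_borel
proof
  fix f :: "nat \<Rightarrow> unit"
  have "(f \<circ> id) \<longlonglongrightarrow> ()"
    by (simp add: tendsto_iff dist_unit_def)
  then show "\<exists>l r. strict_mono r \<and> (f \<circ> r) \<longlonglongrightarrow> l"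
    using strict_mono_id by blast
qed

lemma dim_unit [simp]: "dim (UNIV :: unit set) = 0"
proof -
  have "(UNIV :: unit set) = {0}" by auto
  moreover have "independent ({} :: unit set)" by (rule independent_empty)
  ultimately show ?thesis using dim_eq_card[of "{} :: unit set" UNIV] by simp
qed

definition cone_slab :: "real \<Rightarrow> ('a::{real_inner,heine_borel} \<times> real \<times> real) set" where
  "cone_slab u = {(x, y, z). 0 \<le> y \<and> 0 \<le> z \<and> (norm x)\<^sup>2 \<le> 2 * y * z \<and> z \<le> u}"

definition cone_slab_edge :: "real \<Rightarrow> ('a::{real_inner,heine_borel} \<times> real \<times> real) set" where
  "cone_slab_edge u = {(x, y, z) \<in> cone_slab u. (norm x)\<^sup>2 = 2 * y * z \<and> z = u}"

end

theory Submission
  imports Defs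
begin

text \<open>
  The projection onto a closed convex set is \<open>p\<close> exactly when the residual \<open>w - p\<close> lies in the normal
  cone at \<open>p\<close>. At a point \<open>p = (x, y, u)\<close> of the edge both constraints \<open>\<parallel>x\<parallel>\<^sup>2 \<le> 2 y z\<close> and \<open>z \<le> u\<close>
  are active, with gradients proportional to \<open>(x, - u, - y)\<close> and \<open>(0, 0, 1)\<close>, so the normal cone
  consists of the vectors \<open>(l x, - l u, m - l y)\<close> with \<open>l, m \<ge> 0\<close>. For the residual
  \<open>(a, b, c)\<close> the multiplier must be \<open>l = - b / u\<close>, and the conditions become
  \<open>b \<le> 0\<close>, \<open>a = l x\<close> and \<open>c \<ge> - l y\<close>.

  That such vectors are normal rests on the self-duality of the rotated Lorentz cone
  (\<open>inner_le_of_rotated_cone\<close>), which also gives convexity of the slab. Conversely, three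
  kinds of feasible points force this form: moving in the
  direction of \<open>y\<close> gives \<open>b \<le> 0\<close>, moving along the paraboloid in the face \<open>z = u\<close> gives \<open>a = l x\<close>,
  and comparing with the apex \<open>0\<close> gives \<open>c \<ge> - l y\<close> (\<open>edge_normal_iff\<close>).

  With \<open>y = \<parallel>x\<parallel>\<^sup>2 / (2 u)\<close>, the denominator in (iv) is \<open>2 u\<^sup>2 (1 + l)\<close>, so (iv) is \<open>a = l x\<close>, and then
  (iii) is \<open>c \<ge> - l y\<close>. Condition (ii) follows from (i) and (iv), because \<open>xh = (1 + l) x\<close>.
\<close>

text \<open>
  Cauchy-Schwarz bounds the left side by the geometric mean of \<open>2 y z'\<close> and \<open>2 y' z\<close>,
  and their arithmetic mean is the right side.
\<close>

lemma inner_le_of_rotated_cone: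
  fixes x x' :: "'a::real_inner" and y z y' z' :: real
  assumes "(norm x)\<^sup>2 \<le> 2 * y * z" "0 \<le> y" "0 \<le> z"
    and "(norm x')\<^sup>2 \<le> 2 * y' * z'" "0 \<le> y'" "0 \<le> z'"
  shows "x \<bullet> x' \<le> y * z' + y' * z"
proof -
  have "(norm x * norm x')\<^sup>2 \<le> (2 * y * z) * (2 * y' * z')"
    unfolding power_mult_distrib by (rule mult_mono) (use assms in auto)
  also have "\<dots> = (y * z' + y' * z)\<^sup>2 - (y * z' - y' * z)\<^sup>2"
    by (simp add: power2_eq_square algebra_simps)
  also have "\<dots> \<le> (y * z' + y' * z)\<^sup>2" by simp
  finally have "norm x * norm x' \<le> y * z' + y' * z"
    by (rule power2_le_imp_le) (use assms in simp)
  then show ?thesis using norm_cauchy_schwarz[of x x'] by linarith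
qed

lemma convex_cone_slab: "convex (cone_slab u)"
proof (rule convexI)
  fix p q :: "'a \<times> real \<times> real" and s t :: real
  assume p: "p \<in> cone_slab u" and q: "q \<in> cone_slab u" and st: "0 \<le> s" "0 \<le> t" "s + t = 1"
  obtain x y z x' y' z' where pq: "p = (x, y, z)" "q = (x', y', z')"
    by (metis prod.exhaust)
  have P: "0 \<le> y" "0 \<le> z" "(norm x)\<^sup>2 \<le> 2 * y * z" "z \<le> u"
    and Q: "0 \<le> y'" "0 \<le> z'" "(norm x')\<^sup>2 \<le> 2 * y' * z'" "z' \<le> u"
    using p q by (auto simp: pq cone_slab_def)
  have "(norm (s *\<^sub>R x + t *\<^sub>R x'))\<^sup>2 = s\<^sup>2 * (norm x)\<^sup>2 + t\<^sup>2 * (norm x')\<^sup>2 + 2 * (s * t) * (x \<bullet> x')"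
    unfolding power2_norm_eq_inner
    by (simp add: inner_simps inner_commute power2_eq_square algebra_simps)
  also have "\<dots> \<le> s\<^sup>2 * (2 * y * z) + t\<^sup>2 * (2 * y' * z') + 2 * (s * t) * (y * z' + y' * z)"
    using P Q st by (intro add_mono mult_left_mono inner_le_of_rotated_cone) auto
  also have "\<dots> = 2 * (s * y + t * y') * (s * z + t * z')"
    by (simp add: power2_eq_square algebra_simps)
  finally have "(norm (s *\<^sub>R x + t *\<^sub>R x'))\<^sup>2 \<le> 2 * (s * y + t * y') * (s * z + t * z')" .
  moreover have "s * z + t * z' \<le> u"
    using P Q st by (intro convex_bound_le)
  moreover have "0 \<le> s * y + t * y'" "0 \<le> s * z + t * z'"
    using P Q st by simp_all
  ultimately show "s *\<^sub>R p + t *\<^sub>R q \<in> cone_slab u"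
    unfolding pq cone_slab_def by simp
qed

lemma closed_cone_slab: "closed (cone_slab u)"
  unfolding cone_slab_def case_prod_unfold
  by (intro closed_Collect_conj closed_Collect_le continuous_intros)

lemma closest_point_eq_iff_inner_le:
  fixes S :: "'a::{real_inner,heine_borel} set"
  assumes "convex S" "closed S" "p \<in> S"
  shows "closest_point S w = p \<longleftrightarrow> (\<forall>q\<in>S. (w - p) \<bullet> (q - p) \<le> 0)"
proof
  assume "closest_point S w = p"
  then show "\<forall>q\<in>S. (w - p) \<bullet> (q - p) \<le> 0"
    using closest_point_dot[OF assms(1,2)] by blast
next
  assume normal: "\<forall>q\<in>S. (w - p) \<bullet> (q - p) \<le> 0"
  have "dist w p \<le> dist w q" if "q \<in> S" for q
  proof -
    have "(dist w q)\<^sup>2 = (dist w p)\<^sup>2 + (norm (q - p))\<^sup>2 - 2 * ((w - p) \<bullet> (q - p))"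
      by (simp add: dist_norm power2_norm_eq_inner inner_simps inner_commute)
    then have "(dist w p)\<^sup>2 \<le> (dist w q)\<^sup>2"
      using normal that by (smt (verit) zero_le_power2)
    then show ?thesis by (rule power2_le_imp_le) simp
  qed
  then show "closest_point S w = p"
    using closest_point_unique[OF assms(1-3)] by force
qed

text \<open>
  The normal cone at an edge point. The multiplier of the quadratic constraint is \<open>- b / u\<close>, as
  forced by the \<open>y\<close>-component, and the constraint \<open>z \<le> u\<close> contributes the slack in the
  \<open>z\<close>-component.
\<close>

lemma edge_normal_iff:
  fixes x a :: "'a::{real_inner,heine_borel}" and y u b c :: real
  assumes "u > 0" "0 \<le> y" and edge: "(norm x)\<^sup>2 = 2 * y * u"
  shows "(\<forall>q\<in>cone_slab u. (a, b, c) \<bullet> (q - (x, y, u)) \<le> 0) \<longleftrightarrow>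
    b \<le> 0 \<and> a = (- b / u) *\<^sub>R x \<and> b * y / u \<le> c"
proof
  assume normal: "\<forall>q\<in>cone_slab u. (a, b, c) \<bullet> (q - (x, y, u)) \<le> 0"
  have test: "a \<bullet> (x' - x) + b * (y' - y) + c * (z' - u) \<le> 0"
    if "0 \<le> y'" "0 \<le> z'" "(norm x')\<^sup>2 \<le> 2 * y' * z'" "z' \<le> u" for x' y' z'
    using normal[rule_format, of "(x', y', z')"] that by (simp add: cone_slab_def)
  have "(norm x)\<^sup>2 \<le> 2 * (y + 1) * u"
    using edge \<open>u > 0\<close> by (simp add: algebra_simps)
  then have b: "b \<le> 0"
    using test[of "y + 1" u x] assms by simp
  \<comment> \<open>The direction is the gradient along the face \<open>z = u\<close>, i.e. of
    \<open>x' \<mapsto> a \<bullet> x' + b \<parallel>x'\<parallel>\<^sup>2 / (2 u)\<close> at \<open>x\<close>. The first-order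
    gain \<open>t \<parallel>d\<parallel>\<^sup>2\<close> would exceed the second-order loss for this step length \<open>t\<close>.\<close>
  define d where "d = a + (b / u) *\<^sub>R x"
  define t where "t = u / (u - b)"
  have t: "0 < t" "t * (u - b) = u"
    using b \<open>u > 0\<close> by (auto simp: t_def)
  have le: "a \<bullet> (t *\<^sub>R d) + b * ((norm (x + t *\<^sub>R d))\<^sup>2 / (2 * u) - y) \<le> 0"
    using test[of "(norm (x + t *\<^sub>R d))\<^sup>2 / (2 * u)" u "x + t *\<^sub>R d"] \<open>u > 0\<close> by simp
  have curve: "(norm (x + t *\<^sub>R d))\<^sup>2 = 2 * y * u + 2 * t * (x \<bullet> d) + t\<^sup>2 * (d \<bullet> d)"
    unfolding edge[symmetric] power2_norm_eq_inner
    by (simp add: inner_simps inner_commute power2_eq_square algebra_simps)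
  have grad: "a \<bullet> d = d \<bullet> d - b / u * (x \<bullet> d)"
    by (simp add: d_def inner_simps inner_commute[of x a] algebra_simps)
  have "a \<bullet> (t *\<^sub>R d) + b * ((norm (x + t *\<^sub>R d))\<^sup>2 / (2 * u) - y) =
      t * (d \<bullet> d) * (1 + b * t / (2 * u))"
    unfolding inner_scaleR_right grad curve
    using \<open>u > 0\<close> by (simp add: field_simps power2_eq_square)
  with le have "t * (d \<bullet> d) * (1 + b * t / (2 * u)) \<le> 0" by simp
  moreover have "b * t + 2 * u = u * (t + 1)"
    using t(2) by (simp add: algebra_simps)
  then have "1 + b * t / (2 * u) = (t + 1) / 2"
    using \<open>u > 0\<close> by (simp add: field_simps)
  then have "0 < 1 + b * t / (2 * u)"
    using t(1) by simp
  ultimately have "d \<bullet> d \<le> 0"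
    using t by (simp add: mult_le_0_iff zero_less_mult_iff)
  then have "d = 0"
    by (metis inner_ge_zero inner_eq_zero_iff order_antisym)
  then have a: "a = (- b / u) *\<^sub>R x"
    by (simp add: d_def eq_neg_iff_add_eq_0)
  have "- (a \<bullet> x) - b * y - c * u \<le> 0"
    using test[of 0 0 0] \<open>u > 0\<close> by simp
  moreover have "a \<bullet> x = - 2 * b * y"
    using edge \<open>u > 0\<close> by (simp add: a dot_square_norm)
  ultimately have "b * y / u \<le> c"
    using \<open>u > 0\<close> by (simp add: field_simps)
  with a b show "b \<le> 0 \<and> a = (- b / u) *\<^sub>R x \<and> b * y / u \<le> c" by blast
next
  assume kkt: "b \<le> 0 \<and> a = (- b / u) *\<^sub>R x \<and> b * y / u \<le> c"
  define l where "l = - b / u"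
  have l: "0 \<le> l" "b = - l * u" "a = l *\<^sub>R x" "- l * y \<le> c"
    using kkt \<open>u > 0\<close> by (auto simp: l_def divide_nonpos_pos)
  show "\<forall>q\<in>cone_slab u. (a, b, c) \<bullet> (q - (x, y, u)) \<le> 0"
  proof
    fix q :: "'a \<times> real \<times> real"
    assume "q \<in> cone_slab u"
    then obtain x' y' z' where q: "q = (x', y', z')"
      and Q: "0 \<le> y'" "0 \<le> z'" "(norm x')\<^sup>2 \<le> 2 * y' * z'" "z' \<le> u"
      by (auto simp: cone_slab_def)
    have "(a, b, c) \<bullet> (q - (x, y, u)) =
        l * (x \<bullet> x' - (y * z' + y' * u)) + (c + l * y) * (z' - u)"
      using edge by (simp add: q l inner_simps dot_square_norm algebra_simps)
    also have "\<dots> \<le> 0"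
    proof (intro add_nonpos_nonpos mult_nonneg_nonpos)
      show "x \<bullet> x' - (y * z' + y' * u) \<le> 0"
        using inner_le_of_rotated_cone[of x y u x' y' z'] assms Q by simp
    qed (use l Q in auto)
    finally show "(a, b, c) \<bullet> (q - (x, y, u)) \<le> 0" .
  qed
qed

theorem lemma3:
  fixes n :: nat and u y z yh zh :: real
    and x xh :: "'a::{real_inner,heine_borel}"
  assumes "n \<ge> 2" and "dim (UNIV :: 'a set) = n - 2"
    and "u > 0"
    and "(x, y, z) \<in> cone_slab_edge u"
  shows "closest_point (cone_slab u) (xh, yh, zh) = (x, y, z) \<longleftrightarrow>
    yh \<le> (norm x)\<^sup>2 / (2 * u) \<and>
    norm x \<le> norm xh \<and>
    zh \<ge> u - 1 / u * (x \<bullet> (xh - x)) - y / u * (yh - (norm x)\<^sup>2 / (2 * u)) \<and>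
    x = (2 * u\<^sup>2 / ((norm x)\<^sup>2 - 2 * u * yh + 2 * u\<^sup>2)) *\<^sub>R xh"
    (is "?proj \<longleftrightarrow> ?i \<and> ?ii \<and> ?iii \<and> ?iv")
proof -
  have edge: "(norm x)\<^sup>2 = 2 * y * u" "0 \<le> y" and z: "z = u" and mem: "(x, y, u) \<in> cone_slab u"
    using assms(4) by (auto simp: cone_slab_edge_def cone_slab_def)
  have y: "(norm x)\<^sup>2 / (2 * u) = y"
    using edge \<open>u > 0\<close> by simp
  define l where "l = (y - yh) / u"
  have yh: "yh = y - l * u"
    using \<open>u > 0\<close> by (simp add: l_def)
  have "?proj \<longleftrightarrow> (\<forall>q\<in>cone_slab u. (xh - x, yh - y, zh - u) \<bullet> (q - (x, y, u)) \<le> 0)"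
    unfolding z using closest_point_eq_iff_inner_le[OF convex_cone_slab closed_cone_slab mem] by simp
  also have "\<dots> \<longleftrightarrow> yh - y \<le> 0 \<and> xh - x = (- (yh - y) / u) *\<^sub>R x \<and> (yh - y) * y / u \<le> zh - u"
    using edge \<open>u > 0\<close> by (intro edge_normal_iff) auto
  also have "\<dots> \<longleftrightarrow> 0 \<le> l \<and> xh = (1 + l) *\<^sub>R x \<and> u - l * y \<le> zh"
    using \<open>u > 0\<close> by (auto simp: yh zero_le_mult_iff algebra_simps)
  also have "\<dots> \<longleftrightarrow> ?i \<and> ?ii \<and> ?iii \<and> ?iv"
  proof (cases "0 \<le> l")
    case False
    then have "\<not> ?i"
      using \<open>u > 0\<close> unfolding y by (simp add: yh zero_le_mult_iff)
    with False show ?thesis by blast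
  next
    case True
    then have i: "?i"
      using \<open>u > 0\<close> unfolding y by (simp add: yh)
    have denom: "(norm x)\<^sup>2 - 2 * u * yh + 2 * u\<^sup>2 = 2 * u\<^sup>2 * (1 + l)"
      unfolding edge by (simp add: yh power2_eq_square algebra_simps)
    have iv: "?iv \<longleftrightarrow> xh = (1 + l) *\<^sub>R x"
      using True \<open>u > 0\<close> unfolding denom
      by (auto simp: divide_simps)
    have ii: "?ii" if "xh = (1 + l) *\<^sub>R x"
      using True that by (simp add: mult_le_cancel_right1)
    have iii: "?iii \<longleftrightarrow> u - l * y \<le> zh" if "xh = (1 + l) *\<^sub>R x"
    proof -
      have "x \<bullet> (xh - x) = l * (2 * y * u)"
        unfolding that edge(1)[symmetric] by (simp add: dot_square_norm algebra_simps)
      then have "u - 1 / u * (x \<bullet> (xh - x)) - y / u * (yh - y) = u - l * y"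
        using \<open>u > 0\<close> by (simp add: yh field_simps)
      then show ?thesis unfolding y by (simp only:)
    qed
    show ?thesis using True i ii iii iv by blast
  qed
  finally show ?thesis .
qed

end
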